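(* Let $m$ be a positive integer and let $G$ be an $m$-sparse graph with $|E(G)|=m(|V(G)|-1)$. Then for every partition $P$ of $V(G)$, $e_G(P)\ge m(|P|-1)+p_0$, where $p_0$ is the number of sets $X\in P$ such that $G[X]$ is not $m$-tree-connected.
   Context: Graphs are finite, loopless, and may have multiple edges. A graph $F$ is $m$-sparse if $e_F(S)\le m|S|-m$ for every nonempty $S\subseteq V(F)$, where $e_F(S)$ is the number of edges of $F$ with both ends in $S$. A graph is $m$-tree-connected if it contains $m$ pairwise edge-disjoint spanning trees (a one-vertex graph is $m$-tree-connected). For a partition $P$ of $V(G)$, $e_G(P)$ is the number of edges of $G$ whose ends lie in different parts of $P$. $G[X]$ is the induced subgraph on $X$. *)

theory Defs
  imports Main "HOL-Library.Disjoint_Sets"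
begin

text \<open>
  Edges have their own identity, so several edges may share the same pair of ends.
  The empty graph is not excluded here.
\<close>

record ('a, 'b) mgraph =
  verts :: "'a set"
  edges :: "'b set"
  ends :: "'b \<Rightarrow> 'a set"

locale multigraph =
  fixes G :: "('a, 'b) mgraph"
  assumes finite_verts: "finite (verts G)"
    and finite_edges: "finite (edges G)"
    and ends_in_verts: "e \<in> edges G \<Longrightarrow> ends G e \<subseteq> verts G"
    and two_ends: "e \<in> edges G \<Longrightarrow> card (ends G e) = 2"

definition edges_within :: "('a, 'b) mgraph \<Rightarrow> 'a set \<Rightarrow> 'b set" where
  "edges_within G S = {e \<in> edges G. ends G e \<subseteq> S}"

definition induced :: "('a, 'b) mgraph \<Rightarrow> 'a set \<Rightarrow> ('a, 'b) mgraph" where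
  "induced G X = G\<lparr>verts := X, edges := edges_within G X\<rparr>"

definition crossing_edges :: "('a, 'b) mgraph \<Rightarrow> 'a set set \<Rightarrow> 'b set" where
  "crossing_edges G P =
     {e \<in> edges G. \<exists>u v. \<exists>X\<in>P. \<exists>Y\<in>P. ends G e = {u, v} \<and> u \<in> X \<and> v \<in> Y \<and> X \<noteq> Y}"

text \<open>The bound is stated over the integers to avoid truncated subtraction.\<close>

definition sparse :: "nat \<Rightarrow> ('a, 'b) mgraph \<Rightarrow> bool" where
  "sparse m F \<longleftrightarrow>
     (\<forall>S. S \<subseteq> verts F \<and> S \<noteq> {} \<longrightarrow>
        int (card (edges_within F S)) \<le> int m * int (card S) - int m)"

definition walk :: "('a, 'b) mgraph \<Rightarrow> 'a list \<Rightarrow> 'b list \<Rightarrow> bool" where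
  "walk G vs es \<longleftrightarrow>
     length vs = Suc (length es) \<and> set vs \<subseteq> verts G \<and> set es \<subseteq> edges G \<and>
     (\<forall>i < length es. ends G (es ! i) = {vs ! i, vs ! Suc i})"

text \<open>
  Distinctness of the edges excludes traversing one edge back and forth,
  while two parallel edges do form a cycle.
\<close>

definition cycle :: "('a, 'b) mgraph \<Rightarrow> 'a list \<Rightarrow> 'b list \<Rightarrow> bool" where
  "cycle G vs es \<longleftrightarrow>
     walk G vs es \<and> es \<noteq> [] \<and> hd vs = last vs \<and> distinct (tl vs) \<and> distinct es"

definition connected_graph :: "('a, 'b) mgraph \<Rightarrow> bool" where
  "connected_graph G \<longleftrightarrow>
     verts G \<noteq> {} \<and>
     (\<forall>u\<in>verts G. \<forall>v\<in>verts G. \<exists>vs es. walk G vs es \<and> hd vs = u \<and> last vs = v)"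

definition tree :: "('a, 'b) mgraph \<Rightarrow> bool" where
  "tree G \<longleftrightarrow> connected_graph G \<and> (\<nexists>vs es. cycle G vs es)"

text \<open>A spanning tree is identified with its edge set.\<close>

definition spanning_tree :: "('a, 'b) mgraph \<Rightarrow> 'b set \<Rightarrow> bool" where
  "spanning_tree G T \<longleftrightarrow> T \<subseteq> edges G \<and> tree (G\<lparr>edges := T\<rparr>)"

text \<open>
  The trees form an indexed family and not a set, so that on a one-vertex graph
  the edgeless spanning tree may be used \<open>m\<close> times; see the lemma below.
\<close>

definition tree_connected :: "nat \<Rightarrow> ('a, 'b) mgraph \<Rightarrow> bool" where
  "tree_connected m G \<longleftrightarrow>
     (\<exists>T :: nat \<Rightarrow> 'b set.
        (\<forall>i<m. spanning_tree G (T i)) \<and> disjoint_family_on T {..<m})"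

lemma tree_connected_one_vertex:
  assumes "verts G = {v}"
  shows "tree_connected m G"
proof -
  have "walk (G\<lparr>edges := {}\<rparr>) [v] []"
    using assms by (simp add: walk_def)
  then have "connected_graph (G\<lparr>edges := {}\<rparr>)"
    using assms unfolding connected_graph_def by fastforce
  moreover have "\<not> cycle (G\<lparr>edges := {}\<rparr>) vs es" for vs es
    by (auto simp: cycle_def walk_def)
  ultimately have "spanning_tree G {}"
    by (simp add: spanning_tree_def tree_def)
  then show ?thesis
    unfolding tree_connected_def
    by (intro exI[of _ "\<lambda>_. {}"]) (simp add: disjoint_family_on_def)
qed

end

theory Submission
  imports Defs
begin

text \<open>
  The crossing edges are what remains of the \<open>m (|V| - 1)\<close> edges after removing those inside the
  parts, and sparsity allows at most \<open>m |X| - m\<close> edges inside a part \<open>X\<close>. A part for which this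
  bound is attained is \<open>m\<close>-tree-connected, so every other part gains one crossing edge.

  For the claim about tight parts, sparsity says that every edge set \<open>A\<close> satisfies
  \<open>|A| \<le> m r(A)\<close> for the graphic rank \<open>r\<close>. A Rado-type argument then splits the edges into \<open>m\<close>
  classes \<open>T\<close> with \<open>|T| \<le> r(T)\<close>: starting from \<open>m\<close> copies of the edge set, one discards an edge from
  one of two copies containing it, and submodularity shows that one of the two choices
  preserves the inequality. By counting, each class has \<open>|V| - 1\<close> edges and full rank, and hence is
  a spanning tree.
\<close>

section \<open>Partitioning by a submodular function\<close>

text \<open>Induction on the total size of the sets \<open>S i\<close>, with the bound for all
  \<open>A\<close> as invariant. While two sets share an element, it can be deleted from one of
  them. Once the sets are disjoint, the bound at \<open>A = S i\<close> retains only the summand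
  \<open>r (S i)\<close>.\<close>

lemma submodular_partition:
  fixes r :: "'b set \<Rightarrow> int" and S :: "'i \<Rightarrow> 'b set"
  assumes "finite I" "finite E" and r_empty: "r {} = 0"
    and r_mono: "\<And>A B. A \<subseteq> B \<Longrightarrow> B \<subseteq> E \<Longrightarrow> r A \<le> r B"
    and r_submod: "\<And>A B. A \<subseteq> E \<Longrightarrow> B \<subseteq> E \<Longrightarrow> r (A \<union> B) + r (A \<inter> B) \<le> r A + r B"
    and "\<And>i. i \<in> I \<Longrightarrow> S i \<subseteq> E"
    and "\<And>A. A \<subseteq> E \<Longrightarrow> int (card A) \<le> (\<Sum>i\<in>I. r (A \<inter> S i))"
  shows "\<exists>T. (\<forall>i\<in>I. T i \<subseteq> S i \<and> int (card (T i)) \<le> r (T i)) \<and>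
           disjoint_family_on T I \<and> (\<Union>i\<in>I. T i) = E"
  using assms(6,7)
proof (induction "\<Sum>i\<in>I. card (S i)" arbitrary: S rule: less_induct)
  case less
  note sub = less.prems(1) and bound = less.prems(2)
  show ?case
  proof (cases "disjoint_family_on S I")
    case True
    \<comment> \<open>An element in no \<open>S i\<close> would violate the bound for its singleton,
      since every summand would be \<open>r {} = 0\<close>.\<close>
    have "E \<subseteq> (\<Union>i\<in>I. S i)"
    proof
      fix e assume "e \<in> E"
      then have "1 \<le> (\<Sum>i\<in>I. r ({e} \<inter> S i))"
        using bound[of "{e}"] by simp
      then obtain i where "i \<in> I" "r ({e} \<inter> S i) \<noteq> 0"
        by (metis not_one_le_zero sum.neutral)
      moreover from this have "e \<in> S i"
        using r_empty by (cases "e \<in> S i") simp_all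
      ultimately show "e \<in> (\<Union>i\<in>I. S i)"
        by blast
    qed
    moreover have "int (card (S i)) \<le> r (S i)" if i: "i \<in> I" for i
    proof -
      have "(\<Sum>j\<in>I. r (S i \<inter> S j)) = (\<Sum>j\<in>I. if i = j then r (S i) else 0)"
        using True i r_empty by (intro sum.cong) (auto simp: disjoint_family_on_def)
      then show ?thesis
        using bound[OF sub[OF i]] i \<open>finite I\<close> by simp
    qed
    ultimately show ?thesis
      using True sub by (intro exI[of _ S]) blast
  next
    case False
    then obtain i k e where ik: "i \<in> I" "k \<in> I" "i \<noteq> k" and e: "e \<in> S i" "e \<in> S k"
      by (auto simp: disjoint_family_on_def)
    define S' where "S' l = S(l := S l - {e})" for l
    have S'_sub: "S' l j \<subseteq> S j" for l j
      by (auto simp: S'_def)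
    \<comment> \<open>If both deletions failed, their violators \<open>A\<close> and
      \<open>B\<close> could be uncrossed: the old bound, applied to \<open>A \<union> B\<close> and
      to \<open>A \<inter> B - {e}\<close>, would contradict the two failures.\<close>
    have "\<exists>l\<in>{i, k}. \<forall>A\<subseteq>E. int (card A) \<le> (\<Sum>j\<in>I. r (A \<inter> S' l j))"
    proof (rule ccontr)
      assume "\<not> ?thesis"
      then obtain A B where A: "A \<subseteq> E" "(\<Sum>j\<in>I. r (A \<inter> S' i j)) < int (card A)"
        and B: "B \<subseteq> E" "(\<Sum>j\<in>I. r (B \<inter> S' k j)) < int (card B)"
        by (force simp: not_le)
      \<comment> \<open>A violator must contain \<open>e\<close>, as otherwise the deletion leaves
        its intersections with the sets unchanged.\<close>
      have mem: "e \<in> C" if "C \<subseteq> E" "(\<Sum>j\<in>I. r (C \<inter> S' l j)) < int (card C)" for C l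
      proof (rule ccontr)
        assume "e \<notin> C"
        then have "C \<inter> S' l j = C \<inter> S j" for j
          by (auto simp: S'_def)
        then show False
          using bound[of C] that by simp
      qed
      have eA: "e \<in> A" and eB: "e \<in> B"
        using mem A B by auto
      \<comment> \<open>The deletions hit different indices, so the union recovers \<open>e\<close>:
        for \<open>j = i\<close> from \<open>B\<close>, for \<open>j = k\<close> from
        \<open>A\<close>. The intersection may lose \<open>e\<close>, which is why
        \<open>A \<inter> B - {e}\<close> appears.\<close>
      have "r ((A \<union> B) \<inter> S j) + r ((A \<inter> B - {e}) \<inter> S j) \<le> r (A \<inter> S' i j) + r (B \<inter> S' k j)"
        for j
      proof -
        have "(A \<union> B) \<inter> S j = (A \<inter> S' i j) \<union> (B \<inter> S' k j)"
          using ik eA eB by (auto simp: S'_def)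
        moreover have "r ((A \<inter> B - {e}) \<inter> S j) \<le> r ((A \<inter> S' i j) \<inter> (B \<inter> S' k j))"
          using A(1) by (intro r_mono) (auto simp: S'_def)
        moreover have "A \<inter> S' i j \<subseteq> E" "B \<inter> S' k j \<subseteq> E"
          using A(1) B(1) by auto
        ultimately show ?thesis
          using r_submod[of "A \<inter> S' i j" "B \<inter> S' k j"] by simp
      qed
      then have "(\<Sum>j\<in>I. r ((A \<union> B) \<inter> S j)) + (\<Sum>j\<in>I. r ((A \<inter> B - {e}) \<inter> S j))
          \<le> (\<Sum>j\<in>I. r (A \<inter> S' i j)) + (\<Sum>j\<in>I. r (B \<inter> S' k j))"
        unfolding sum.distrib[symmetric] by (intro sum_mono)
      moreover have "int (card (A \<union> B)) \<le> (\<Sum>j\<in>I. r ((A \<union> B) \<inter> S j))"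
        "int (card (A \<inter> B - {e})) \<le> (\<Sum>j\<in>I. r ((A \<inter> B - {e}) \<inter> S j))"
        using A(1) B(1) by (blast intro: bound)+
      moreover have fin: "finite A" "finite B"
        using A(1) B(1) \<open>finite E\<close> finite_subset by auto
      \<comment> \<open>Only one unit is lost on the left, which is at least |A| + |B| - 1. The two
        strict failures bound the right by |A| + |B| - 2.\<close>
      moreover have "card (A \<inter> B) = Suc (card (A \<inter> B - {e}))"
        using fin eA eB card.remove[of "A \<inter> B" e] by simp
      moreover have "card A + card B = card (A \<union> B) + card (A \<inter> B)"
        using fin by (rule card_Un_Int)
      ultimately show False
        using A(2) B(2) by linarith
    qed
    then obtain l where l: "l \<in> {i, k}"
      and bound': "\<And>A. A \<subseteq> E \<Longrightarrow> int (card A) \<le> (\<Sum>j\<in>I. r (A \<inter> S' l j))"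
      by blast
    have "(\<Sum>j\<in>I. card (S' l j)) < (\<Sum>j\<in>I. card (S j))"
    proof (rule sum_strict_mono_ex1[OF \<open>finite I\<close>])
      have fin: "finite (S j)" if "j \<in> I" for j
        using sub[OF that] \<open>finite E\<close> by (rule finite_subset)
      then show "\<forall>j\<in>I. card (S' l j) \<le> card (S j)"
        by (simp add: card_mono S'_sub)
      have "card (S' l l) < card (S l)"
        using l e ik fin card_Diff1_less[of "S l" e] by (auto simp: S'_def)
      then show "\<exists>j\<in>I. card (S' l j) < card (S j)"
        using l ik by blast
    qed
    then have "\<exists>T. (\<forall>j\<in>I. T j \<subseteq> S' l j \<and> int (card (T j)) \<le> r (T j)) \<and>
        disjoint_family_on T I \<and> (\<Union>j\<in>I. T j) = E"
      using less.hyps[of "S' l"] bound' subset_trans[OF S'_sub sub] by simp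
    then show ?thesis
      using subset_trans[OF _ S'_sub] by metis
  qed
qed

text \<open>The elements of \<open>A - B\<close> are added one at a time to \<open>B\<close> and to
  \<open>A \<inter> B\<close>. Each gains at most as much over the larger set, and the gains
  telescope.\<close>

lemma submodular_if_diminishing:
  fixes r :: "'b set \<Rightarrow> int"
  assumes "finite E"
    and dim: "\<And>A B e. A \<subseteq> B \<Longrightarrow> B \<subseteq> E \<Longrightarrow> e \<in> E \<Longrightarrow> e \<notin> B \<Longrightarrow>
      r (insert e B) - r B \<le> r (insert e A) - r A"
    and "A \<subseteq> E" "B \<subseteq> E"
  shows "r (A \<union> B) + r (A \<inter> B) \<le> r A + r B"
proof -
  have "r (C \<union> B) - r B \<le> r (C \<union> (A \<inter> B)) - r (A \<inter> B)" if "finite C" "C \<subseteq> A - B" for C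
    using that
  proof (induction C)
    case (insert e C)
    then have "r (insert e (C \<union> B)) - r (C \<union> B)
        \<le> r (insert e (C \<union> (A \<inter> B))) - r (C \<union> (A \<inter> B))"
      using assms(3,4) by (intro dim) auto
    then show ?case
      using insert by simp
  qed simp
  from this[of "A - B"] finite_subset[OF assms(3,1)] show ?thesis
    by (simp add: Un_Diff_Int)
qed

section \<open>The graphic rank\<close>

text \<open>Living on the whole vertex type makes this an equivalence on \<open>UNIV\<close> without
  side conditions; \<open>components\<close> then keeps only the classes of vertices of the
  graph.\<close>

definition reach :: "('a, 'b) mgraph \<Rightarrow> 'b set \<Rightarrow> ('a \<times> 'a) set" where
  "reach G A = {(u, v). \<exists>e\<in>A. ends G e = {u, v}}\<^sup>*"

definition components :: "('a, 'b) mgraph \<Rightarrow> 'b set \<Rightarrow> 'a set set" where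
  "components G A = verts G // reach G A"

text \<open>This is the rank function of the cycle matroid, with integer values so that differences
  do not truncate.\<close>

definition graphic_rank :: "('a, 'b) mgraph \<Rightarrow> 'b set \<Rightarrow> int" where
  "graphic_rank G A = int (card (verts G)) - int (card (components G A))"

section \<open>Reachability as an equivalence relation\<close>

lemma reach_refl: "(u, u) \<in> reach G A"
  by (simp add: reach_def)

lemma reach_edge: "e \<in> A \<Longrightarrow> ends G e = {u, v} \<Longrightarrow> (u, v) \<in> reach G A"
  by (auto simp: reach_def)

lemma reach_trans: "(u, v) \<in> reach G A \<Longrightarrow> (v, w) \<in> reach G A \<Longrightarrow> (u, w) \<in> reach G A"
  unfolding reach_def by (rule rtrancl_trans)

lemma reach_sym: "(u, v) \<in> reach G A \<Longrightarrow> (v, u) \<in> reach G A"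
  unfolding reach_def by (rule symD[OF sym_rtrancl]) (auto simp: sym_def insert_commute)

lemma equiv_reach: "equiv UNIV (reach G A)"
  by (rule equivI) (auto intro: refl_onI symI transI reach_refl reach_sym reach_trans)

lemma reach_class_eq_iff: "reach G A `` {u} = reach G A `` {v} \<longleftrightarrow> (u, v) \<in> reach G A"
  using eq_equiv_class_iff[OF equiv_reach] by simp

lemma reach_mono: "A \<subseteq> B \<Longrightarrow> reach G A \<subseteq> reach G B"
  unfolding reach_def by (intro rtrancl_mono) auto

text \<open>The new edge contributes the pairs \<open>(x, y)\<close> and \<open>(y, x)\<close>, and
  a path needs at most one of them once: by symmetry of the old relation, longer detours
  collapse.\<close>

lemma reach_insert:
  assumes "ends G e = {x, y}"
  shows "reach G (insert e A) = reach G A \<union>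
    {(u, v). (u, x) \<in> reach G A \<and> (y, v) \<in> reach G A \<or> (u, y) \<in> reach G A \<and> (x, v) \<in> reach G A}"
proof -
  have "{(u, v). \<exists>f\<in>insert e A. ends G f = {u, v}} =
      insert (x, y) (insert (y, x) {(u, v). \<exists>f\<in>A. ends G f = {u, v}})"
    using assms by (auto simp: doubleton_eq_iff)
  then have "reach G (insert e A) =
      (insert (x, y) (insert (y, x) {(u, v). \<exists>f\<in>A. ends G f = {u, v}}))\<^sup>*"
    by (simp add: reach_def)
  also have "\<dots> = reach G A \<union>
    {(u, v). (u, x) \<in> reach G A \<and> (y, v) \<in> reach G A \<or> (u, y) \<in> reach G A \<and> (x, v) \<in> reach G A}"
    unfolding rtrancl_insert reach_def[symmetric]
    by (auto intro: reach_trans reach_sym reach_refl)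
  finally show ?thesis .
qed

lemma component_eq:
  assumes "C \<in> components G A" "u \<in> C"
  shows "C = reach G A `` {u}"
proof -
  obtain w where "C = reach G A `` {w}"
    using assms(1) unfolding components_def quotient_def by blast
  then show ?thesis
    using assms(2) by (simp add: reach_class_eq_iff)
qed

section \<open>Components and the effect of a new edge\<close>

context multigraph
begin

lemma finite_components: "finite (components G A)"
  unfolding components_def quotient_def using finite_verts by simp

lemma reach_in_verts:
  assumes "A \<subseteq> edges G" "(u, v) \<in> reach G A" "u \<in> verts G"
  shows "v \<in> verts G"
  using assms(2,3) unfolding reach_def
  by (induction rule: rtrancl_induct) (use assms(1) ends_in_verts in fastforce)+

text \<open>Only vertices that reach \<open>x\<close> or \<open>y\<close> change their class, which
  becomes the union of the two. If the two classes coincide, the formula removes one set and puts it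
  back.\<close>

lemma components_insert:
  assumes "ends G e = {x, y}" "x \<in> verts G" "y \<in> verts G"
  shows "components G (insert e A) =
    insert (reach G A `` {x} \<union> reach G A `` {y})
      (components G A - {reach G A `` {x}, reach G A `` {y}})"
proof -
  let ?R = "reach G A"
  have new: "reach G (insert e A) `` {u} =
      (if (u, x) \<in> ?R \<or> (u, y) \<in> ?R then ?R `` {x} \<union> ?R `` {y} else ?R `` {u})" for u
    unfolding reach_insert[OF assms(1)] by (auto intro: reach_trans reach_sym reach_refl)
  have comps: "components G B = (\<lambda>u. reach G B `` {u}) ` verts G" for B
    by (auto simp: components_def quotient_def)
  show ?thesis
  proof
    show "components G (insert e A) \<subseteq>
        insert (?R `` {x} \<union> ?R `` {y}) (components G A - {?R `` {x}, ?R `` {y}})"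
    proof
      fix C assume "C \<in> components G (insert e A)"
      then obtain u where u: "u \<in> verts G" "C = reach G (insert e A) `` {u}"
        unfolding comps by blast
      show "C \<in> insert (?R `` {x} \<union> ?R `` {y}) (components G A - {?R `` {x}, ?R `` {y}})"
      proof (cases "(u, x) \<in> ?R \<or> (u, y) \<in> ?R")
        case True
        then show ?thesis
          using new u(2) by simp
      next
        case False
        then have "C = ?R `` {u}" "C \<noteq> ?R `` {x}" "C \<noteq> ?R `` {y}"
          using new u(2) by (simp_all add: reach_class_eq_iff)
        then show ?thesis
          using u(1) unfolding comps by blast
      qed
    qed
    have "?R `` {x} \<union> ?R `` {y} = reach G (insert e A) `` {x}"
      using new[of x] reach_refl[of x G A] by simp
    then have "?R `` {x} \<union> ?R `` {y} \<in> components G (insert e A)"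
      using assms(2) unfolding comps by blast
    moreover have "C \<in> components G (insert e A)"
      if C: "C \<in> components G A" "C \<noteq> ?R `` {x}" "C \<noteq> ?R `` {y}" for C
    proof -
      obtain u where u: "u \<in> verts G" "C = ?R `` {u}"
        using C(1) unfolding comps by blast
      then have "C = reach G (insert e A) `` {u}"
        using C(2,3) new by (simp add: reach_class_eq_iff)
      then show ?thesis
        using u(1) unfolding comps by blast
    qed
    ultimately show "insert (?R `` {x} \<union> ?R `` {y}) (components G A - {?R `` {x}, ?R `` {y}})
        \<subseteq> components G (insert e A)"
      by blast
  qed
qed

lemma card_components_insert:
  assumes "e \<in> edges G" "ends G e = {x, y}"
  shows "card (components G A) =
    card (components G (insert e A)) + (if (x, y) \<in> reach G A then 0 else 1)"
proof -
  let ?X = "reach G A `` {x}" and ?Y = "reach G A `` {y}"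
  have v: "x \<in> verts G" "y \<in> verts G"
    using ends_in_verts[OF assms(1)] assms(2) by auto
  then have mem: "?X \<in> components G A" "?Y \<in> components G A"
    by (auto simp: components_def intro: quotientI)
  show ?thesis
  proof (cases "(x, y) \<in> reach G A")
    case True
    then have "?X = ?Y"
      by (simp add: reach_class_eq_iff)
    then show ?thesis
      using True mem components_insert[OF assms(2) v] by (simp add: insert_absorb)
  next
    case False
    then have neq: "?X \<noteq> ?Y"
      by (simp add: reach_class_eq_iff)
    \<comment> \<open>Were the merged set an old component, it would be the class of
      \<open>x\<close> and contain \<open>y\<close>. Hence two sets leave and a genuinely new one
      enters.\<close>
    have "?X \<union> ?Y \<notin> components G A"
      using False component_eq[of "?X \<union> ?Y" G A x] reach_refl[of x G A] reach_refl[of y G A]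
      by blast
    then have "card (components G (insert e A)) =
        Suc (card (components G A - {?X, ?Y}))"
      using components_insert[OF assms(2) v] finite_components by simp
    \<comment> \<open>This keeps the subtraction of 2 on the naturals from truncating.\<close>
    moreover have "card {?X, ?Y} \<le> card (components G A)"
      using mem finite_components by (intro card_mono) auto
    ultimately show ?thesis
      using False neq mem finite_components by (simp add: card_Diff_subset)
  qed
qed

section \<open>Rank properties of edge sets\<close>

lemma rank_insert:
  assumes "e \<in> edges G" "ends G e = {x, y}"
  shows "graphic_rank G (insert e A) =
    graphic_rank G A + (if (x, y) \<in> reach G A then 0 else 1)"
  using card_components_insert[OF assms, of A] by (simp add: graphic_rank_def)

lemma edge_ends:
  assumes "e \<in> edges G"
  obtains x y where "ends G e = {x, y}"
  using two_ends[OF assms] by (auto simp: card_2_iff)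

lemma rank_empty: "graphic_rank G {} = 0"
proof -
  have "components G {} = (\<lambda>v. {v}) ` verts G"
    by (auto simp: components_def quotient_def reach_def)
  then show ?thesis
    by (simp add: graphic_rank_def card_image)
qed

lemma rank_insert_le:
  assumes "e \<in> edges G"
  shows "graphic_rank G A \<le> graphic_rank G (insert e A)"
    and "graphic_rank G (insert e A) \<le> graphic_rank G A + 1"
  by (rule edge_ends[OF assms], simp add: rank_insert assms)+

lemma rank_mono:
  assumes "A \<subseteq> B" "B \<subseteq> edges G"
  shows "graphic_rank G A \<le> graphic_rank G B"
proof -
  have "graphic_rank G A \<le> graphic_rank G (A \<union> D)" if "finite D" "D \<subseteq> B" for D
    using that
  proof (induction D)
    case (insert e D)
    then show ?case
      using rank_insert_le(1)[of e "A \<union> D"] assms(2) by force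
  qed simp
  from this[of B] finite_subset[OF assms(2) finite_edges] assms(1) show ?thesis
    by (simp add: Un_absorb1)
qed

text \<open>An edge gains 1 exactly when its ends are not yet connected. A larger edge set connects
  more pairs, so gains can only drop.\<close>

lemma rank_submod:
  assumes "A \<subseteq> edges G" "B \<subseteq> edges G"
  shows "graphic_rank G (A \<union> B) + graphic_rank G (A \<inter> B) \<le> graphic_rank G A + graphic_rank G B"
proof (rule submodular_if_diminishing[OF finite_edges _ assms])
  fix A B :: "'b set" and e assume "A \<subseteq> B" "e \<in> edges G"
  moreover obtain x y where "ends G e = {x, y}"
    using edge_ends[OF \<open>e \<in> edges G\<close>] .
  ultimately show "graphic_rank G (insert e B) - graphic_rank G B
      \<le> graphic_rank G (insert e A) - graphic_rank G A"
    using reach_mono[of A B G] by (auto simp: rank_insert)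
qed

lemma rank_le_card:
  assumes "A \<subseteq> edges G"
  shows "graphic_rank G A \<le> int (card A)"
proof -
  have "finite A"
    using assms finite_edges finite_subset by blast
  then show ?thesis
    using assms
  proof (induction A)
    case (insert e A)
    then show ?case
      using rank_insert_le(2)[of e A] by simp
  qed (simp add: rank_empty)
qed

section \<open>Sparsity as a rank bound\<close>

lemma card_components_pos:
  assumes "verts G \<noteq> {}"
  shows "0 < card (components G A)"
  using assms finite_components by (auto simp: card_gt_0_iff components_def quotient_def)

lemma component_nonempty:
  assumes "C \<in> components G A"
  shows "C \<noteq> {}"
proof -
  obtain u where "C = reach G A `` {u}"
    using assms unfolding components_def quotient_def by blast
  then show ?thesis
    using reach_refl[of u G A] by blast
qed

lemma component_subset:
  assumes "A \<subseteq> edges G" "C \<in> components G A"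
  shows "C \<subseteq> verts G"
  using assms by (auto simp: components_def quotient_def intro: reach_in_verts)

lemma sum_card_components:
  assumes "A \<subseteq> edges G"
  shows "(\<Sum>C\<in>components G A. card C) = card (verts G)"
proof -
  have "\<Union> (components G A) = verts G"
  proof
    show "\<Union> (components G A) \<subseteq> verts G"
      using component_subset[OF assms] by blast
    show "verts G \<subseteq> \<Union> (components G A)"
      by (auto simp: components_def quotient_def intro: reach_refl)
  qed
  moreover have "pairwise disjnt (components G A)"
  proof (rule disjointI, rule ccontr)
    fix C D assume "C \<in> components G A" "D \<in> components G A" "C \<noteq> D" "C \<inter> D \<noteq> {}"
    then show False
      using component_eq by (metis disjoint_iff)
  qed
  then have "card (\<Union> (components G A)) = (\<Sum>C\<in>components G A. card C)"
    using component_subset[OF assms] finite_verts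
    by (intro card_Union_disjoint) (auto intro: finite_subset)
  ultimately show ?thesis
    by simp
qed

text \<open>Every edge of \<open>A\<close> lies within one component of \<open>A\<close>. Summing
  the sparsity bound m|C| - m over the components \<open>C\<close> gives m times (|V| minus their
  number), which is m times the rank.\<close>

lemma sparse_card_le_rank:
  assumes "sparse m G" "A \<subseteq> edges G"
  shows "int (card A) \<le> int m * graphic_rank G A"
proof -
  let ?K = "components G A"
  have "A \<subseteq> (\<Union>C\<in>?K. edges_within G C)"
  proof
    fix e assume e: "e \<in> A"
    then obtain x y where xy: "ends G e = {x, y}"
      using edge_ends assms(2) by blast
    then have "ends G e \<subseteq> reach G A `` {x}"
      using e reach_edge reach_refl by fastforce
    moreover have "reach G A `` {x} \<in> ?K"
      using xy e assms(2) ends_in_verts unfolding components_def by (blast intro: quotientI)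
    ultimately show "e \<in> (\<Union>C\<in>?K. edges_within G C)"
      using e assms(2) by (auto simp: edges_within_def)
  qed
  then have "card A \<le> card (\<Union>C\<in>?K. edges_within G C)"
    using finite_components finite_edges by (intro card_mono) (auto simp: edges_within_def)
  also have "\<dots> \<le> (\<Sum>C\<in>?K. card (edges_within G C))"
    by (rule card_UN_le[OF finite_components])
  finally have "int (card A) \<le> (\<Sum>C\<in>?K. int (card (edges_within G C)))"
    by (simp flip: of_nat_sum)
  also have "\<dots> \<le> (\<Sum>C\<in>?K. int m * int (card C) - int m)"
    using assms(1) component_subset[OF assms(2)] component_nonempty
    by (intro sum_mono) (auto simp: sparse_def)
  also have "\<dots> = int m * (int (\<Sum>C\<in>?K. card C) - int (card ?K))"
    by (simp add: sum_subtractf sum_distrib_left algebra_simps)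
  finally show ?thesis
    by (simp add: sum_card_components[OF assms(2)] graphic_rank_def)
qed

end

section \<open>Spanning trees and tight graphs\<close>

lemma walk_Cons_Cons:
  "walk G (u # v # vs) (e # es) \<longleftrightarrow>
     u \<in> verts G \<and> e \<in> edges G \<and> ends G e = {u, v} \<and> walk G (v # vs) es"
  by (auto simp: walk_def All_less_Suc2)

text \<open>Using only the edges of the walk itself matters for cycles: the rest of a cycle then
  joins the ends of its first edge without that edge.\<close>

lemma walk_imp_reach:
  assumes "walk G vs es"
  shows "(hd vs, last vs) \<in> reach G (set es)"
  using assms
proof (induction es arbitrary: vs)
  case Nil
  then show ?case
    by (auto simp: walk_def length_Suc_conv reach_refl)
next
  case (Cons e es)
  then obtain u v ws where vs: "vs = u # v # ws"
    by (auto simp: walk_def length_Suc_conv)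
  then have "(v, last vs) \<in> reach G (set es)" "ends G e = {u, v}"
    using Cons.IH[of "v # ws"] Cons.prems by (simp_all add: walk_Cons_Cons)
  then have "(v, last vs) \<in> reach G (set (e # es))" "(u, v) \<in> reach G (set (e # es))"
    using reach_mono[of "set es" "set (e # es)" G] reach_edge[of e "set (e # es)"] by auto
  then show ?case
    using vs reach_trans by fastforce
qed

context multigraph
begin

text \<open>Induction from the front, as walks grow by consing. Every vertex before the last is an
  end of an edge of \<open>A\<close>, hence in \<open>verts G\<close>.\<close>

lemma reach_imp_walk:
  assumes "A \<subseteq> edges G" "(u, v) \<in> reach G A" "v \<in> verts G"
  shows "\<exists>vs es. walk (G\<lparr>edges := A\<rparr>) vs es \<and> hd vs = u \<and> last vs = v"
  using assms(2) unfolding reach_def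
proof (induction rule: converse_rtrancl_induct)
  case base
  have "walk (G\<lparr>edges := A\<rparr>) [v] []"
    using assms(3) by (simp add: walk_def)
  then show ?case
    by fastforce
next
  case (step u w)
  then obtain e vs es where e: "e \<in> A" "ends G e = {u, w}"
    and w: "walk (G\<lparr>edges := A\<rparr>) vs es" "hd vs = w" "last vs = v"
    by auto
  from w obtain ws where vs: "vs = w # ws"
    by (cases vs) (auto simp: walk_def)
  then have "walk (G\<lparr>edges := A\<rparr>) (u # w # ws) (e # es)"
    using e w assms(1) ends_in_verts[of e] by (auto simp: walk_Cons_Cons)
  then show ?case
    using vs w by (intro exI[of _ "u # w # ws"] exI[of _ "e # es"]) simp
qed

text \<open>Full rank leaves a single component, so the graph is connected. On a cycle, an edge
  could be deleted without loss of rank, forcing the rank below |A|.\<close>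

lemma spanning_tree_if_full_rank:
  assumes "verts G \<noteq> {}" and A: "A \<subseteq> edges G" and "int (card A) \<le> graphic_rank G A"
    and "graphic_rank G A = int (card (verts G)) - 1"
  shows "spanning_tree G A"
proof -
  have "card (components G A) = 1"
    using assms(4) by (simp add: graphic_rank_def)
  then obtain C where C: "components G A = {C}"
    by (auto simp: card_1_singleton_iff)
  have "(u, v) \<in> reach G A" if "u \<in> verts G" "v \<in> verts G" for u v
  proof -
    have "reach G A `` {u} \<in> components G A" "reach G A `` {v} \<in> components G A"
      using that unfolding components_def by (auto intro: quotientI)
    then have "reach G A `` {u} = reach G A `` {v}"
      using C by simp
    then show ?thesis
      by (simp add: reach_class_eq_iff)
  qed
  then have "connected_graph (G\<lparr>edges := A\<rparr>)"
    using assms(1) reach_imp_walk[OF A] by (simp add: connected_graph_def)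
  moreover have "\<not> cycle (G\<lparr>edges := A\<rparr>) vs es" for vs es
  proof
    assume cyc: "cycle (G\<lparr>edges := A\<rparr>) vs es"
    then obtain e es' where es: "es = e # es'"
      by (cases es) (auto simp: cycle_def)
    then obtain u v ws where vs: "vs = u # v # ws"
      using cyc by (auto simp: cycle_def walk_def length_Suc_conv)
    have e: "e \<in> A" "ends G e = {u, v}" "walk (G\<lparr>edges := A\<rparr>) (v # ws) es'"
      and "last (v # ws) = u" "e \<notin> set es'" "set es' \<subseteq> A"
      using cyc by (auto simp: es vs cycle_def walk_Cons_Cons walk_def)
    then have "(v, u) \<in> reach (G\<lparr>edges := A\<rparr>) (set es')"
      using walk_imp_reach[OF e(3)] by simp
    \<comment> \<open>\<open>reach\<close> reads only \<open>ends\<close>, which restricting the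
      edge set does not alter.\<close>
    then have "(v, u) \<in> reach G (set es')"
      by (simp add: reach_def)
    moreover have "set es' \<subseteq> A - {e}"
      using \<open>e \<notin> set es'\<close> \<open>set es' \<subseteq> A\<close> by blast
    ultimately have "(u, v) \<in> reach G (A - {e})"
      using reach_mono reach_sym by (metis subsetD)
    then have "graphic_rank G A = graphic_rank G (A - {e})"
      using rank_insert[of e u v "A - {e}"] e A by (auto simp: insert_absorb)
    also have "\<dots> \<le> int (card (A - {e}))"
      using A by (intro rank_le_card) auto
    also have "\<dots> < int (card A)"
      using e(1) A finite_edges finite_subset by (metis card_Diff1_less of_nat_less_iff)
    finally show False
      using assms(3) by simp
  qed
  ultimately show ?thesis
    using A by (simp add: spanning_tree_def tree_def)
qed

lemma tree_connected_if_tight: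
  assumes "verts G \<noteq> {}" "sparse m G"
    and tight: "int (card (edges G)) = int m * (int (card (verts G)) - 1)"
  shows "tree_connected m G"
proof -
  let ?r = "graphic_rank G"
  have "\<exists>T. (\<forall>i\<in>{..<m}. T i \<subseteq> edges G \<and> int (card (T i)) \<le> ?r (T i)) \<and>
      disjoint_family_on T {..<m} \<and> (\<Union>i<m. T i) = edges G"
  \<comment> \<open>All \<open>m\<close> initial sets are the full edge set, so the required bound
    reads |A| \<le> m r(A), which is what sparsity provides.\<close>
  proof (rule submodular_partition)
    fix A assume "A \<subseteq> edges G"
    then show "int (card A) \<le> (\<Sum>i<m. ?r (A \<inter> edges G))"
      using sparse_card_le_rank[OF assms(2)] by (simp add: Int_absorb2)
  qed (use finite_edges rank_empty rank_mono rank_submod in auto)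
  then obtain T where T_all: "\<forall>i\<in>{..<m}. T i \<subseteq> edges G \<and> int (card (T i)) \<le> ?r (T i)"
    and disj: "disjoint_family_on T {..<m}" and un: "(\<Union>i<m. T i) = edges G"
    by (elim exE conjE)
  have T: "T i \<subseteq> edges G" "int (card (T i)) \<le> ?r (T i)" if "i < m" for i
    using T_all that by simp_all
  have upper: "?r A \<le> int (card (verts G)) - 1" for A
    using card_components_pos[OF assms(1), of A] by (simp add: graphic_rank_def)
  have fin: "finite (T i)" if "i < m" for i
    using T(1)[OF that] finite_edges by (rule finite_subset)
  have "int (card (edges G)) = (\<Sum>i<m. int (card (T i)))"
    using card_UN_disjoint'[OF disj] fin un by simp
  \<comment> \<open>The classes fall short of |V| - 1 edges by nonnegative amounts with sum zero, so
    none falls short.\<close>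
  then have "(\<Sum>i<m. (int (card (verts G)) - 1) - int (card (T i))) = 0"
    using tight by (simp add: sum_subtractf)
  moreover have "0 \<le> (int (card (verts G)) - 1) - int (card (T i))" if "i < m" for i
    using T(2)[OF that] upper[of "T i"] by simp
  ultimately have "\<forall>i\<in>{..<m}. (int (card (verts G)) - 1) - int (card (T i)) = 0"
    by (subst (asm) sum_nonneg_eq_0_iff) auto
  then have "spanning_tree G (T i)" if "i < m" for i
    using that T[OF that] upper[of "T i"] by (intro spanning_tree_if_full_rank assms(1)) auto
  then show ?thesis
    using disj unfolding tree_connected_def by blast
qed

end

section \<open>Partitions of a tight sparse graph\<close>

lemma edges_within_induced:
  "S \<subseteq> X \<Longrightarrow> edges_within (induced G X) S = edges_within G S"
  by (auto simp: edges_within_def induced_def)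

lemma multigraph_induced:
  assumes "multigraph G" "X \<subseteq> verts G"
  shows "multigraph (induced G X)"
proof -
  interpret multigraph G by fact
  show ?thesis
    using finite_subset[OF assms(2) finite_verts] finite_edges two_ends
    by unfold_locales (auto simp: induced_def edges_within_def)
qed

text \<open>Sparsity passes to the induced graph, so attaining the bound m|X| - m would make that
  graph tight and thus tree-connected. Integrality turns the strict inequality into a gain of
  1.\<close>

lemma card_edges_within_lt:
  assumes "multigraph G" "sparse m G" "X \<subseteq> verts G" "X \<noteq> {}"
    and "\<not> tree_connected m (induced G X)"
  shows "int (card (edges_within G X)) \<le> int m * int (card X) - int m - 1"
proof -
  have "sparse m (induced G X)"
    unfolding sparse_def
  proof (intro allI impI)
    fix S assume "S \<subseteq> verts (induced G X) \<and> S \<noteq> {}"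
    then have "S \<subseteq> X" "S \<noteq> {}"
      by (auto simp: induced_def)
    then show "int (card (edges_within (induced G X) S)) \<le> int m * int (card S) - int m"
      using assms(2,3) by (simp add: edges_within_induced sparse_def)
  qed
  then have "int (card (edges_within G X)) \<noteq> int m * (int (card X) - 1)"
    using multigraph.tree_connected_if_tight[OF multigraph_induced[OF assms(1,3)]] assms(4,5)
    by (auto simp: induced_def)
  moreover have "int (card (edges_within G X)) \<le> int m * int (card X) - int m"
    using assms(2-4) by (simp add: sparse_def)
  ultimately show ?thesis
    by (simp add: algebra_simps)
qed

text \<open>The ends of an edge lie in one part or in two different parts; disjointness of the parts
  makes these cases exclusive and the single part unique.\<close>

lemma card_crossing_edges:
  assumes "multigraph G" and P: "partition_on (verts G) P"
  shows "card (edges G) = card (crossing_edges G P) + (\<Sum>X\<in>P. card (edges_within G X))"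
proof -
  interpret multigraph G by fact
  have disj: "X = Y" if "X \<in> P" "Y \<in> P" "v \<in> X" "v \<in> Y" for X Y v
    using partition_onD2[OF P] that by (auto simp: disjoint_def)
  have finP: "finite P"
    using finite_elements[OF finite_verts P] .
  have split: "edges G = crossing_edges G P \<union> (\<Union>X\<in>P. edges_within G X)"
  proof
    show "edges G \<subseteq> crossing_edges G P \<union> (\<Union>X\<in>P. edges_within G X)"
    proof
      fix e assume e: "e \<in> edges G"
      then obtain u v where uv: "ends G e = {u, v}"
        by (rule edge_ends)
      then have "u \<in> \<Union> P" "v \<in> \<Union> P"
        using ends_in_verts[OF e] partition_onD1[OF P] by simp_all
      then obtain X Y where XY: "X \<in> P" "Y \<in> P" "u \<in> X" "v \<in> Y"
        by blast
      show "e \<in> crossing_edges G P \<union> (\<Union>X\<in>P. edges_within G X)"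
      proof (cases "X = Y")
        case True
        then have "e \<in> edges_within G X"
          using e uv XY by (simp add: edges_within_def)
        then show ?thesis
          using XY(1) by blast
      next
        case False
        then have "e \<in> crossing_edges G P"
          unfolding crossing_edges_def using e uv XY by blast
        then show ?thesis
          by blast
      qed
    qed
  qed (auto simp: crossing_edges_def edges_within_def)
  have "crossing_edges G P \<inter> (\<Union>X\<in>P. edges_within G X) = {}"
  proof (rule ccontr)
    assume "\<not> ?thesis"
    then obtain e Z where e: "e \<in> crossing_edges G P" and Z: "Z \<in> P" "ends G e \<subseteq> Z"
      by (auto simp: edges_within_def)
    from e obtain u v X Y where "X \<in> P" "Y \<in> P" "ends G e = {u, v}" "u \<in> X" "v \<in> Y" "X \<noteq> Y"
      unfolding crossing_edges_def by blast
    then show False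
      using disj[of X Z u] disj[of Y Z v] Z by auto
  qed
  then have "card (edges G) = card (crossing_edges G P) + card (\<Union>X\<in>P. edges_within G X)"
    using card_Un_disjoint[of "crossing_edges G P" "\<Union>X\<in>P. edges_within G X"]
      finite_edges split by simp
  also have "card (\<Union>X\<in>P. edges_within G X) = (\<Sum>X\<in>P. card (edges_within G X))"
  proof (rule card_UN_disjoint[OF finP])
    show "\<forall>X\<in>P. finite (edges_within G X)"
      using finite_edges by (simp add: edges_within_def)
    \<comment> \<open>Edges have ends, so an edge within two parts would give them a common
      vertex.\<close>
    show "\<forall>X\<in>P. \<forall>Y\<in>P. X \<noteq> Y \<longrightarrow> edges_within G X \<inter> edges_within G Y = {}"
    proof (intro ballI impI, rule ccontr)
      fix X Y assume XY: "X \<in> P" "Y \<in> P" "X \<noteq> Y" "edges_within G X \<inter> edges_within G Y \<noteq> {}"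
      then obtain e where "e \<in> edges G" "ends G e \<subseteq> X" "ends G e \<subseteq> Y"
        by (auto simp: edges_within_def)
      then show False
        using XY disj edge_ends by (metis insert_subset)
    qed
  qed
  finally show ?thesis .
qed

theorem theorem2p4:
  fixes G :: "('a, 'b) mgraph" and m :: nat and P :: "'a set set"
  assumes "multigraph G"
    and "m \<ge> 1"
    and "sparse m G"
    and "int (card (edges G)) = int m * (int (card (verts G)) - 1)"
    and "partition_on (verts G) P"
  shows "int (card (crossing_edges G P)) \<ge>
           int m * (int (card P) - 1) +
           int (card {X \<in> P. \<not> tree_connected m (induced G X)})"
proof -
  let ?Q = "{X \<in> P. \<not> tree_connected m (induced G X)}"
  have finV: "finite (verts G)"
    using assms(1) by (rule multigraph.finite_verts)
  then have finP: "finite P"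
    using finite_elements assms(5) by blast
  have part: "X \<subseteq> verts G" "X \<noteq> {}" if "X \<in> P" for X
    using partition_onD1[OF assms(5)] partition_onD3[OF assms(5)] that by auto
  \<comment> \<open>The indicator records the one edge by which a part that is not tree-connected
    misses the sparsity bound; it sums to the size of \<open>?Q\<close>.\<close>
  have "(\<Sum>X\<in>P. int (card (edges_within G X)))
      \<le> (\<Sum>X\<in>P. int m * int (card X) - int m - (if X \<in> ?Q then 1 else 0))"
    using card_edges_within_lt[OF assms(1,3) part] assms(3) part
    by (intro sum_mono) (auto simp: sparse_def)
  also have "\<dots> = int m * int (\<Sum>X\<in>P. card X) - int m * int (card P) - int (card ?Q)"
    using finP by (simp add: sum_subtractf sum_distrib_left sum.If_cases Int_def)
  also have "(\<Sum>X\<in>P. card X) = card (verts G)"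
    unfolding partition_onD1[OF assms(5)]
    using partition_onD2[OF assms(5)] part(1) finV
    by (intro card_Union_disjoint[symmetric]) (auto intro: finite_subset)
  \<comment> \<open>Subtracting m|V| - m|P| - |\<open>?Q\<close>| from m(|V| - 1) leaves m(|P| - 1)
    + |\<open>?Q\<close>|.\<close>
  finally show ?thesis
    using card_crossing_edges[OF assms(1,5)] assms(4) by (simp add: algebra_simps)
qed

end
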